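(* Let $\mathcal{M}$ be a meridian surface in $\mathbb{R}^4$ of the general class, given by $z(u,v)=f(u)\,l(v)+g(u)\,e_4$, $u\in I$, $v\in J$, with spherical curve $c: l=l(v)$ on $S^2(1)$ and meridian curve $m: u\mapsto (f(u),g(u))$. Then $\mathcal{M}$ has parallel normal bundle if and only if one of the following cases holds: (i) the meridian $m$ is defined by $$f(u)=\pm\sqrt{u^2+2cu+d},\qquad g(u)=\pm\sqrt{d-c^2}\,\ln\left|u+c+\sqrt{u^2+2cu+d}\right|+a,$$ where $a$, $c$, and $d$ are constants, $d>c^2$; (ii) the curve $c$ is a circle on $S^2(1)$ with constant spherical curvature $\kappa=\mathrm{const}=b$, $b>0$, and the meridian $m$ is determined by $\dot f=y(f)$, where $$y(t)=\pm\frac{\sqrt{(1-a^2)\,t^2-2ac\,t-c^2}}{t},\qquad a=\mathrm{const}\neq0,\quad c=\mathrm{const},$$ and $g(u)$ is defined by $\dot g(u)=\sqrt{1-\dot f^2(u)}$. (In the displayed formulas the letter $c$ denotes a real constant, not the curve.)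
   Context: Setting. $\mathbb{R}^4$ is Euclidean 4-space with standard orthonormal frame $\{e_1,e_2,e_3,e_4\}$ and metric $\langle\cdot,\cdot\rangle$; $S^2(1)$ is the unit sphere centered at the origin in $\mathbb{R}^3=\mathrm{span}\{e_1,e_2,e_3\}$. Dots denote $d/du$ and primes on $l,t,n$ denote $d/dv$; $I,J\subset\mathbb{R}$ are intervals. Meridian surfaces. Let $f,g$ be smooth functions on $I$ with $\dot f^2+\dot g^2=1$ and $f\neq 0$, and let $c: l=l(v)$, $v\in J$, be a smooth curve on $S^2(1)$ parametrized by arc length. Put $t(v)=l'(v)$ and let $\{t(v),n(v),l(v)\}$ be the orthonormal moving frame of $c$ in $\mathbb{R}^3$, with Frenet formulas $l'=t$, $t'=\kappa n-l$, $n'=-\kappa t$, where $\kappa=\kappa(v)$ is the spherical curvature of $c$. The surface $\mathcal{M}: z(u,v)=f(u)\,l(v)+g(u)\,e_4$, $u\in I$, $v\in J$, is called a meridian surface; the curve $m: u\mapsto(f(u),g(u))$ is its meridian curve, with curvature $\kappa_m=\dot f\ddot g-\dot g\ddot f$. The conventions are: $\dot g>0$, so that $\dot g=\sqrt{1-\dot f^2}$ and $\kappa_m=-\ddot f/\sqrt{1-\dot f^2}$; the sign of $\kappa$ depends on the choice of sign of $n$ (orientation of $c$), and when $\kappa$ is nowhere zero this is chosen so that $\kappa>0$. The description of the meridian in (ii) is local: the sign $\pm$ in $y$ may be chosen separately on subintervals of $I$ on which $\dot f$ has no zeros. General class. $\mathcal{M}$ is of the general class if $\kappa_m(u)\neq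 0$ for all $u\in I$ and $\kappa(v)\neq 0$ for all $v\in J$. Parallel normal bundle. Let $H=\frac12\,\mathrm{tr}\,\sigma$ be the mean curvature vector field of a surface in $\mathbb{R}^4$ ($\sigma$ the second fundamental tensor) and $D$ its normal connection (the normal component of the flat connection of $\mathbb{R}^4$ applied to normal fields). For a surface with $H\neq0$ everywhere, the geometric normal frame field is the orthonormal normal frame $\{\mathbf{b},\mathbf{l}\}$ with $\mathbf{b}$ collinear with $H$ (the vector field $\mathbf{l}$ here is not the curve $l(v)$, and $\mathbf{b}$ is not the constant $b$). The surface is said to have parallel normal bundle if $\mathbf{b}$ and $\mathbf{l}$ are parallel in the normal bundle, i.e. $D_x\mathbf{b}=0$ and $D_x\mathbf{l}=0$ for every tangent vector field $x$. (For a meridian surface of the general class, $H\neq0$ everywhere.) *)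

theory Defs
  imports "HOL-Analysis.Analysis"
begin

text \<open>
  The parameter intervals may be open, half-open or closed, so all derivatives are taken
  within them (one-sided at end points).
\<close>

definition nondegenerate_interval :: "real set \<Rightarrow> bool" where
  "nondegenerate_interval I \<longleftrightarrow> is_interval I \<and> interior I \<noteq> {}"

definition deriv_within :: "real set \<Rightarrow> (real \<Rightarrow> 'a::real_normed_vector) \<Rightarrow> real \<Rightarrow> 'a" where
  "deriv_within I h u = vector_derivative h (at u within I)"

definition smooth_on_interval :: "real set \<Rightarrow> (real \<Rightarrow> 'a::real_normed_vector) \<Rightarrow> bool" where
  "smooth_on_interval I h \<longleftrightarrow> (\<forall>k. ((deriv_within I ^^ k) h) differentiable_on I)"


subsection \<open>Parametrized surfaces in a Euclidean space\<close>

text \<open>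
  A surface is an immersion \<open>z\<close> of a set \<open>S\<close> of parameters \<open>p = (u, v)\<close>. Tangent vectors at \<open>p\<close>
  are written as \<open>dz\<^sub>p(\<xi>)\<close> with \<open>\<xi>\<close> a vector of the parameter plane, and vector fields along the
  surface are functions of the parameters.
\<close>

definition differential ::
  "(real \<times> real) set \<Rightarrow> (real \<times> real \<Rightarrow> 'a::euclidean_space) \<Rightarrow> real \<times> real \<Rightarrow> real \<times> real \<Rightarrow> 'a"
  where "differential S w p = frechet_derivative w (at p within S)"

definition tangent_space ::
  "(real \<times> real) set \<Rightarrow> (real \<times> real \<Rightarrow> 'a::euclidean_space) \<Rightarrow> real \<times> real \<Rightarrow> 'a set"
  where "tangent_space S z p = range (differential S z p)"

definition normal_space ::
  "(real \<times> real) set \<Rightarrow> (real \<times> real \<Rightarrow> 'a::euclidean_space) \<Rightarrow> real \<times> real \<Rightarrow> 'a set"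
  where "normal_space S z p = orthogonal_comp (tangent_space S z p)"

definition normal_part ::
  "(real \<times> real) set \<Rightarrow> (real \<times> real \<Rightarrow> 'a::euclidean_space) \<Rightarrow> real \<times> real \<Rightarrow> 'a \<Rightarrow> 'a"
  where "normal_part S z p x = (THE y. y \<in> normal_space S z p \<and> x - y \<in> tangent_space S z p)"

definition first_form ::
  "(real \<times> real) set \<Rightarrow> (real \<times> real \<Rightarrow> 'a::euclidean_space) \<Rightarrow> real \<times> real \<Rightarrow>
    real \<times> real \<Rightarrow> real \<times> real \<Rightarrow> real"
  where "first_form S z p \<xi> \<eta> = differential S z p \<xi> \<bullet> differential S z p \<eta>"

text \<open>
  Gauss formula: \<open>\<sigma>(dz(\<xi>), dz(\<eta>))\<close> is the normal part of the flat derivative in direction \<open>\<xi>\<close> of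
  the tangent field \<open>dz(\<eta>)\<close>, where \<open>\<eta>\<close> is extended as a constant field in the parameter plane.
\<close>

definition second_form ::
  "(real \<times> real) set \<Rightarrow> (real \<times> real \<Rightarrow> 'a::euclidean_space) \<Rightarrow> real \<times> real \<Rightarrow>
    real \<times> real \<Rightarrow> real \<times> real \<Rightarrow> 'a"
  where "second_form S z p \<xi> \<eta> =
    normal_part S z p (differential S (\<lambda>q. differential S z q \<eta>) p \<xi>)"

text \<open>
  \<open>H = (tr \<sigma>) / 2\<close>. The trace is the one with respect to the induced metric, i.e. the sum of
  \<open>g\<^sup>i\<^sup>j \<sigma>\<^sub>i\<^sub>j\<close> with \<open>g\<^sup>i\<^sup>j\<close> the inverse of the matrix of coefficients \<open>E\<close>, \<open>F\<close>, \<open>G\<close>.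
\<close>

definition mean_curvature_vector ::
  "(real \<times> real) set \<Rightarrow> (real \<times> real \<Rightarrow> 'a::euclidean_space) \<Rightarrow> real \<times> real \<Rightarrow> 'a"
  where "mean_curvature_vector S z p =
    (let E = first_form S z p (1, 0) (1, 0);
         F = first_form S z p (1, 0) (0, 1);
         G = first_form S z p (0, 1) (0, 1);
         tr = (1 / (E * G - F\<^sup>2)) *\<^sub>R
           (G *\<^sub>R second_form S z p (1, 0) (1, 0)
            - (2 * F) *\<^sub>R second_form S z p (1, 0) (0, 1)
            + E *\<^sub>R second_form S z p (0, 1) (0, 1))
     in (1 / 2) *\<^sub>R tr)"

text \<open>\<open>normal_connection S z \<nu> p \<xi>\<close> is \<open>D\<^sub>x \<nu>\<close> at \<open>p\<close> for the tangent vector \<open>x = dz\<^sub>p(\<xi>)\<close>.\<close>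

definition normal_connection ::
  "(real \<times> real) set \<Rightarrow> (real \<times> real \<Rightarrow> 'a::euclidean_space) \<Rightarrow> (real \<times> real \<Rightarrow> 'a) \<Rightarrow>
    real \<times> real \<Rightarrow> real \<times> real \<Rightarrow> 'a"
  where "normal_connection S z \<nu> p \<xi> = normal_part S z p (differential S \<nu> p \<xi>)"

text \<open>
  The geometric normal frame is determined by the surface up to the signs of its two members.
  On a smooth connected surface in a 4-dimensional space, differentiability fixes these signs
  globally and already makes the members smooth.
\<close>

definition geometric_normal_frame ::
  "(real \<times> real) set \<Rightarrow> (real \<times> real \<Rightarrow> real^4) \<Rightarrow>
    (real \<times> real \<Rightarrow> real^4) \<Rightarrow> (real \<times> real \<Rightarrow> real^4) \<Rightarrow> bool"
  where "geometric_normal_frame S z \<b> \<l> \<longleftrightarrow>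
    \<b> differentiable_on S \<and> \<l> differentiable_on S \<and>
    (\<forall>p\<in>S. mean_curvature_vector S z p \<noteq> 0 \<and>
      \<b> p \<in> normal_space S z p \<and> \<l> p \<in> normal_space S z p \<and>
      norm (\<b> p) = 1 \<and> norm (\<l> p) = 1 \<and> \<b> p \<bullet> \<l> p = 0 \<and>
      collinear {0, mean_curvature_vector S z p, \<b> p})"

definition parallel_normal_bundle ::
  "(real \<times> real) set \<Rightarrow> (real \<times> real \<Rightarrow> real^4) \<Rightarrow> bool"
  where "parallel_normal_bundle S z \<longleftrightarrow>
    (\<exists>\<b> \<l>. geometric_normal_frame S z \<b> \<l> \<and>
      (\<forall>p\<in>S. \<forall>\<xi>. normal_connection S z \<b> p \<xi> = 0 \<and> normal_connection S z \<l> p \<xi> = 0))"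


subsection \<open>Meridian surfaces\<close>

definition span_e123 :: "(real^4) set" where
  "span_e123 = span {axis 1 1, axis 2 1, axis 3 1}"

definition sphere2 :: "(real^4) set" where
  "sphere2 = sphere 0 1 \<inter> span_e123"

definition circle_on_sphere2 :: "(real^4) set \<Rightarrow> bool" where
  "circle_on_sphere2 C \<longleftrightarrow>
    (\<exists>w h. w \<in> span_e123 \<and> norm w = 1 \<and> \<bar>h\<bar> < 1 \<and> C = {x \<in> sphere2. x \<bullet> w = h})"

definition meridian_curve :: "real set \<Rightarrow> (real \<Rightarrow> real) \<Rightarrow> (real \<Rightarrow> real) \<Rightarrow> bool" where
  "meridian_curve I f g \<longleftrightarrow>
    nondegenerate_interval I \<and> smooth_on_interval I f \<and> smooth_on_interval I g \<and>
    (\<forall>u\<in>I. (deriv_within I f u)\<^sup>2 + (deriv_within I g u)\<^sup>2 = 1 \<and> f u \<noteq> 0 \<and> deriv_within I g u > 0)"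

definition meridian_curvature ::
  "real set \<Rightarrow> (real \<Rightarrow> real) \<Rightarrow> (real \<Rightarrow> real) \<Rightarrow> real \<Rightarrow> real"
  where "meridian_curvature I f g u =
    deriv_within I f u * deriv_within I (deriv_within I g) u
    - deriv_within I g u * deriv_within I (deriv_within I f) u"

text \<open>
  A unit speed curve \<open>l\<close> on the sphere with a choice of the smooth unit normal \<open>n\<close>, so that
  \<open>t = l'\<close>, \<open>n\<close>, \<open>l\<close> is an orthonormal frame of the span of \<open>e\<^sub>1\<close>, \<open>e\<^sub>2\<close>, \<open>e\<^sub>3\<close>. The Frenet formulas
  follow with \<open>\<kappa> = t' \<bullet> n\<close>.
\<close>

definition spherical_curve_with_normal ::
  "real set \<Rightarrow> (real \<Rightarrow> real^4) \<Rightarrow> (real \<Rightarrow> real^4) \<Rightarrow> bool"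
  where "spherical_curve_with_normal J l n \<longleftrightarrow>
    nondegenerate_interval J \<and> smooth_on_interval J l \<and> smooth_on_interval J n \<and>
    (\<forall>v\<in>J. l v \<in> sphere2 \<and> norm (deriv_within J l v) = 1 \<and>
      n v \<in> span_e123 \<and> norm (n v) = 1 \<and> n v \<bullet> l v = 0 \<and> n v \<bullet> deriv_within J l v = 0)"

definition spherical_curvature ::
  "real set \<Rightarrow> (real \<Rightarrow> real^4) \<Rightarrow> (real \<Rightarrow> real^4) \<Rightarrow> real \<Rightarrow> real"
  where "spherical_curvature J l n v = deriv_within J (deriv_within J l) v \<bullet> n v"

definition meridian_surface ::
  "(real \<Rightarrow> real) \<Rightarrow> (real \<Rightarrow> real) \<Rightarrow> (real \<Rightarrow> real^4) \<Rightarrow> real \<times> real \<Rightarrow> real^4"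
  where "meridian_surface f g l = (\<lambda>(u, v). f u *\<^sub>R l v + g u *\<^sub>R axis 4 1)"

definition general_class ::
  "real set \<Rightarrow> real set \<Rightarrow> (real \<Rightarrow> real) \<Rightarrow> (real \<Rightarrow> real) \<Rightarrow>
    (real \<Rightarrow> real^4) \<Rightarrow> (real \<Rightarrow> real^4) \<Rightarrow> bool"
  where "general_class I J f g l n \<longleftrightarrow>
    (\<forall>u\<in>I. meridian_curvature I f g u \<noteq> 0) \<and> (\<forall>v\<in>J. spherical_curvature J l n v \<noteq> 0)"

definition slope_radicand :: "real \<Rightarrow> real \<Rightarrow> real \<Rightarrow> real" where
  "slope_radicand a c t = (1 - a\<^sup>2) * t\<^sup>2 - 2 * a * c * t - c\<^sup>2"

text \<open>
  \<open>f' = y(f)\<close> on \<open>I\<close> with \<open>y(t) = \<plusminus> sqrt (slope_radicand a c t) / t\<close>. The sign is a function \<open>s\<close>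
  which has to be constant on each subinterval of \<open>I\<close> where \<open>f'\<close> has no zeros. Since \<open>sqrt\<close> is
  also defined on negative numbers, the radicand is explicitly required to be nonnegative.
\<close>

definition satisfies_slope_equation ::
  "real set \<Rightarrow> (real \<Rightarrow> real) \<Rightarrow> real \<Rightarrow> real \<Rightarrow> bool"
  where "satisfies_slope_equation I f a c \<longleftrightarrow>
    (\<exists>s :: real \<Rightarrow> real.
      (\<forall>u\<in>I. s u \<in> {1, -1}) \<and>
      (\<forall>K. K \<subseteq> I \<and> is_interval K \<and> (\<forall>u\<in>K. deriv_within I f u \<noteq> 0) \<longrightarrow> s constant_on K) \<and>
      (\<forall>u\<in>I. slope_radicand a c (f u) \<ge> 0 \<and>
        deriv_within I f u = s u * sqrt (slope_radicand a c (f u)) / f u))"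

end

theory Submission
  imports Defs
begin

text \<open>
  Let \<open>X = f' l + g' e\<^sub>4\<close> and \<open>N = - g' l + f' e\<^sub>4\<close>. Then \<open>{X, t, n, N}\<close> is an orthonormal frame with
  \<open>X\<close> and \<open>t\<close> tangent, and both \<open>n\<close> and \<open>N\<close> are parallel in the normal bundle. Moreover
  \<open>H = (\<kappa> n + W N) / (2 f)\<close> with \<open>W = f \<kappa>\<^sub>m + g'\<close>. Hence the geometric frame is parallel iff
  \<open>W(u) = \<mu> \<kappa>(v)\<close> for a constant \<open>\<mu>\<close>, that is, iff \<open>W = 0\<close> or \<open>W\<close> and \<open>\<kappa>\<close> are both constant.
  Since \<open>W g' = 1 - (f f')'\<close>, the first case integrates to \<open>f\<^sup>2 = u\<^sup>2 + 2 c u + d\<close>. Since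
  \<open>(f g')' = f' W\<close>, the second one gives \<open>f g' = a f + c\<close>, whose square is the slope equation.
\<close>

subsection \<open>Derivatives on intervals and orthonormal frames\<close>

text \<open>A connected set with more than one point is perfect. This is what makes one-sided
  derivatives at end points unique.\<close>

lemma interval_at_within_neq_bot:
  assumes "nondegenerate_interval I" "u \<in> I"
  shows "at u within I \<noteq> bot"
proof -
  have "connected I"
    using assms(1) by (simp add: nondegenerate_interval_def is_interval_connected_1)
  moreover have "I \<noteq> {u}"
    using assms(1) by (auto simp: nondegenerate_interval_def)
  ultimately show ?thesis
    using connected_imp_perfect[of I u] assms(2) by (auto simp: trivial_limit_within)
qed

text \<open>The sign of \<open>d\<close> is left open because at an end point only one direction
  stays inside \<open>I\<close>. Uniqueness of Frechet derivatives within a set asks for steps of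
  this kind.\<close>

lemma interval_small_step:
  assumes "nondegenerate_interval I" "u \<in> I" "0 < e"
  shows "\<exists>d. 0 < \<bar>d\<bar> \<and> \<bar>d\<bar> < e \<and> u + d \<in> I"
proof -
  have "u islimpt I"
    using interval_at_within_neq_bot[OF assms(1,2)] by (auto simp: trivial_limit_within)
  then obtain x where "x \<in> I" "x \<noteq> u" "dist x u < e"
    using assms(3) by (meson islimpt_approachable)
  then show ?thesis
    by (intro exI[of _ "x - u"]) (auto simp: dist_real_def)
qed

lemma smooth_on_interval_has_vector_derivative:
  assumes "smooth_on_interval I h" "u \<in> I"
  shows "(h has_vector_derivative deriv_within I h u) (at u within I)"
proof -
  have "h differentiable_on I"
    using assms(1) unfolding smooth_on_interval_def by (metis funpow_0)
  then show ?thesis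
    using assms(2) vector_derivative_works
    by (auto simp: differentiable_on_def deriv_within_def)
qed

lemma smooth_on_interval_deriv_within:
  assumes "smooth_on_interval I h"
  shows "smooth_on_interval I (deriv_within I h)"
  unfolding smooth_on_interval_def
proof
  fix k
  have "((deriv_within I ^^ Suc k) h) differentiable_on I"
    using assms unfolding smooth_on_interval_def by blast
  then show "((deriv_within I ^^ k) (deriv_within I h)) differentiable_on I"
    by (simp only: funpow_Suc_right o_apply)
qed

text \<open>Allows identities that hold only on \<open>I\<close> to be differentiated, end points
  included.\<close>

lemma constant_vector_derivative_zero:
  assumes "nondegenerate_interval I" "u \<in> I" "(h has_vector_derivative D) (at u within I)"
    and "\<And>x. x \<in> I \<Longrightarrow> h x = k"
  shows "D = 0"
proof -
  have "((\<lambda>_. k) has_vector_derivative D) (at u within I)"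
    using has_vector_derivative_transform[OF assms(2) _ assms(3)] assms(4) by metis
  then show ?thesis
    using vector_derivative_unique_within[OF interval_at_within_neq_bot[OF assms(1,2)]]
      has_vector_derivative_const by blast
qed

lemma has_vector_derivative_inner:
  fixes x y :: "real \<Rightarrow> 'a::real_inner"
  assumes "(x has_vector_derivative x') (at v within J)" "(y has_vector_derivative y') (at v within J)"
  shows "((\<lambda>v. x v \<bullet> y v) has_vector_derivative x v \<bullet> y' + x' \<bullet> y v) (at v within J)"
  using bounded_bilinear.has_vector_derivative[OF bounded_bilinear_inner assms] .

text \<open>Pairwise orthogonal nonzero vectors are independent, and four of them span the space by
  dimension.\<close>

lemma orthonormal_frame_expand:
  fixes a b c d x :: "real^4"
  assumes "a \<bullet> a = 1" "b \<bullet> b = 1" "c \<bullet> c = 1" "d \<bullet> d = 1"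
    and "a \<bullet> b = 0" "a \<bullet> c = 0" "a \<bullet> d = 0" "b \<bullet> c = 0" "b \<bullet> d = 0" "c \<bullet> d = 0"
  shows "x = (x \<bullet> a) *\<^sub>R a + (x \<bullet> b) *\<^sub>R b + (x \<bullet> c) *\<^sub>R c + (x \<bullet> d) *\<^sub>R d"
proof -
  let ?B = "{a, b, c, d}"
  have distinct: "a \<noteq> b" "a \<noteq> c" "a \<noteq> d" "b \<noteq> c" "b \<noteq> d" "c \<noteq> d" "0 \<notin> ?B"
    using assms by auto
  have orth: "pairwise orthogonal ?B"
    using assms by (auto simp: pairwise_def orthogonal_def inner_commute)
  have "independent ?B"
    using pairwise_orthogonal_independent[OF orth] distinct by blast
  moreover have "card ?B = 4"
    using distinct by simp
  ultimately have "UNIV \<subseteq> span ?B"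
    by (intro card_ge_dim_independent) auto
  then have "(\<Sum>i\<in>?B. (x \<bullet> i) *\<^sub>R i) = x"
    using orth assms by (intro orthonormal_basis_expand) (auto simp: norm_eq_1)
  then show ?thesis
    using distinct by (simp add: inner_commute add.assoc)
qed

lemma span_e123_iff: "x \<in> span_e123 \<longleftrightarrow> x $ 4 = 0"
proof
  have "subspace {x :: real^4. x $ 4 = 0}"
    by (auto simp: subspace_def)
  then have "span_e123 \<subseteq> {x. x $ 4 = 0}"
    unfolding span_e123_def by (intro span_minimal) (auto simp: axis_def)
  then show "x \<in> span_e123 \<Longrightarrow> x $ 4 = 0" by auto
  assume "x $ 4 = 0"
  then have "x = x $ 1 *\<^sub>R axis 1 1 + x $ 2 *\<^sub>R axis 2 1 + x $ 3 *\<^sub>R axis 3 1"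
    by (auto simp: vec_eq_iff forall_4 axis_def)
  then show "x \<in> span_e123"
    unfolding span_e123_def
    by (metis insertCI span_add span_base span_scale)
qed

lemma sphere2_iff: "x \<in> sphere2 \<longleftrightarrow> x \<bullet> x = 1 \<and> x \<bullet> axis 4 1 = 0"
  by (auto simp: sphere2_def span_e123_iff norm_eq_1 inner_axis)

section \<open>Differentials and normal parts on product domains\<close>

text \<open>Derivatives within a set are unique once every point can be approached along each
  coordinate direction. Hence \<open>differential\<close>, defined through a choice of derivative,
  can be computed from any derivative found by hand.\<close>

lemma frechet_derivative_on_product:
  assumes I: "nondegenerate_interval I" and J: "nondegenerate_interval J"
    and p: "p \<in> I \<times> J" and w: "(w has_derivative w') (at p within I \<times> J)"
  shows "differential (I \<times> J) w p = w'"
proof -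
  have "(w has_derivative differential (I \<times> J) w p) (at p within I \<times> J)"
    using w unfolding differential_def
    by (metis differentiable_def frechet_derivative_works)
  moreover have "\<exists>d. 0 < \<bar>d\<bar> \<and> \<bar>d\<bar> < e \<and> p + d *\<^sub>R i \<in> I \<times> J"
    if "i \<in> Basis" "0 < e" for i :: "real \<times> real" and e
    using that interval_small_step[OF I, of "fst p" e] interval_small_step[OF J, of "snd p" e] p
    by (cases p) (auto simp: Basis_prod_def)
  ultimately show ?thesis
    using frechet_derivative_unique_within[OF _ w] by blast
qed

text \<open>Two candidates differ by a vector that is both tangent and normal, hence orthogonal to
  itself. This evaluates the \<open>THE\<close> in \<open>normal_part\<close>.\<close>

lemma normal_part_eqI:
  assumes "subspace (tangent_space S z p)" "y \<in> normal_space S z p" "x - y \<in> tangent_space S z p"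
  shows "normal_part S z p x = y"
  unfolding normal_part_def
proof (rule the_equality)
  fix y' assume y': "y' \<in> normal_space S z p \<and> x - y' \<in> tangent_space S z p"
  have "(x - y') - (x - y) \<in> tangent_space S z p"
    using assms y' subspace_diff by blast
  then have T: "y - y' \<in> tangent_space S z p" by simp
  then have "(y - y') \<bullet> y = 0" "(y - y') \<bullet> y' = 0"
    using assms(2) y' by (auto simp: normal_space_def orthogonal_comp_def orthogonal_def)
  then have "(y - y') \<bullet> (y - y') = 0" by (simp add: inner_diff_right)
  then show "y' = y" by simp
qed (use assms in auto)


subsection \<open>The meridian\<close>

text \<open>Intermediate value theorem. It turns pointwise choices of a sign into one choice on the
  whole interval.\<close>

lemma continuous_nonzero_sign:
  fixes h :: "real \<Rightarrow> real"
  assumes "is_interval K" "continuous_on K h" "\<And>u. u \<in> K \<Longrightarrow> h u \<noteq> 0"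
  shows "(\<forall>u\<in>K. h u > 0) \<or> (\<forall>u\<in>K. h u < 0)"
proof (rule ccontr)
  assume "\<not> ?thesis"
  then obtain x y where xy: "x \<in> K" "y \<in> K" "h x \<le> 0" "h y \<ge> 0"
    by (auto simp: not_less)
  have "is_interval (h ` K)"
    using assms connected_continuous_image is_interval_connected_1 by blast
  then have "0 \<in> h ` K"
    using xy unfolding is_interval_1 by (meson imageI)
  then show False using assms(3) by force
qed

locale meridian =
  fixes I :: "real set" and f g :: "real \<Rightarrow> real"
  assumes meridian_curve: "meridian_curve I f g"
begin

abbreviation "f1 \<equiv> deriv_within I f"
abbreviation "f2 \<equiv> deriv_within I f1"
abbreviation "g1 \<equiv> deriv_within I g"
abbreviation "g2 \<equiv> deriv_within I g1"
abbreviation "\<kappa>\<^sub>m \<equiv> meridian_curvature I f g"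

text \<open>\<open>W u / f u\<close> is twice the mean curvature of the surface of revolution in
  3-space with profile \<open>(f, g)\<close>, so \<open>W = 0\<close> is the equation of a
  catenary.\<close>

definition W :: "real \<Rightarrow> real" where
  "W u = f u * \<kappa>\<^sub>m u + g1 u"

lemma nondegenerate_I: "nondegenerate_interval I"
  using meridian_curve by (simp add: meridian_curve_def)

lemma is_interval_I: "is_interval I"
  using nondegenerate_I by (simp add: nondegenerate_interval_def)

lemma convex_I: "convex I"
  using nondegenerate_I by (simp add: nondegenerate_interval_def is_interval_convex_1)

lemma meridian_simps:
  assumes "u \<in> I"
  shows "f1 u * f1 u + g1 u * g1 u = 1" "f u \<noteq> 0" "g1 u > 0"
  using assms meridian_curve by (auto simp: meridian_curve_def power2_eq_square)

lemma meridian_derivs: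
  assumes "u \<in> I"
  shows "(f has_real_derivative f1 u) (at u within I)"
    and "(f1 has_real_derivative f2 u) (at u within I)"
    and "(g has_real_derivative g1 u) (at u within I)"
    and "(g1 has_real_derivative g2 u) (at u within I)"
  using assms meridian_curve
  by (auto simp: meridian_curve_def has_real_derivative_iff_has_vector_derivative
      intro!: smooth_on_interval_has_vector_derivative smooth_on_interval_deriv_within)

lemma meridian_derivs_orthogonal:
  assumes u: "u \<in> I"
  shows "f1 u * f2 u + g1 u * g2 u = 0"
proof -
  have "((\<lambda>u. f1 u * f1 u + g1 u * g1 u) has_real_derivative 2 * (f1 u * f2 u + g1 u * g2 u))
      (at u within I)"
    by (auto intro!: derivative_eq_intros meridian_derivs[OF u])
  then show ?thesis
    using constant_vector_derivative_zero[OF nondegenerate_I u, of _ _ 1] meridian_simps(1)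
    by (force simp: has_real_derivative_iff_has_vector_derivative)
qed

text \<open>Unit speed makes \<open>(f2, g2)\<close> orthogonal to the unit vector
  \<open>(f1, g1)\<close>, hence a multiple of \<open>(- g1, f1)\<close>, and the factor is the
  curvature.\<close>

lemma meridian_frenet:
  assumes u: "u \<in> I"
  shows "f1 u * \<kappa>\<^sub>m u = g2 u" "g1 u * \<kappa>\<^sub>m u = - f2 u"
  using meridian_simps(1)[OF u] meridian_derivs_orthogonal[OF u]
  unfolding meridian_curvature_def by algebra+

lemma constant_real_derivative_zero:
  assumes "u \<in> I" "(h has_real_derivative D) (at u within I)" "\<And>x. x \<in> I \<Longrightarrow> h x = k"
  shows "D = 0"
  using constant_vector_derivative_zero[OF nondegenerate_I assms(1) _ assms(3)] assms(2)
  by (simp add: has_real_derivative_iff_has_vector_derivative)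

lemma real_derivative_zero_constant:
  assumes "\<And>u. u \<in> I \<Longrightarrow> (h has_real_derivative 0) (at u within I)"
  shows "\<exists>k. \<forall>u\<in>I. h u = k"
  using has_field_derivative_zero_constant[OF convex_I] assms by blast

lemma continuous_derivs:
  "continuous_on I f" "continuous_on I f1" "continuous_on I g1"
  by (rule DERIV_continuous_on, erule meridian_derivs)+

section \<open>Vanishing \<open>W\<close>: the meridians of case (i)\<close>

lemma W_zero_iff:
  "(\<forall>u\<in>I. W u = 0) \<longleftrightarrow> (\<exists>c. \<forall>u\<in>I. f u * f1 u = u + c)"
proof
  assume W: "\<forall>u\<in>I. W u = 0"
  have "((\<lambda>u. f u * f1 u - u) has_real_derivative 0) (at u within I)" if u: "u \<in> I" for u
  proof -
    \<comment> \<open>Unit speed and \<open>meridian_frenet\<close> turn \<open>W u * g1 u\<close>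
      into \<open>1 - f1 u * f1 u - f u * f2 u\<close>, the derivative of
      \<open>u - f u * f1 u\<close>.\<close>
    have "W u * g1 u = 0" using W u by simp
    then have "f u * f2 u + f1 u * f1 u = 1"
      using meridian_simps(1)[OF u] meridian_frenet[OF u] unfolding W_def by algebra
    then show ?thesis
      by (auto intro!: derivative_eq_intros meridian_derivs[OF u] simp: algebra_simps)
  qed
  then have "\<exists>c. \<forall>u\<in>I. f u * f1 u - u = c"
    by (rule real_derivative_zero_constant)
  then obtain c where "\<And>u. u \<in> I \<Longrightarrow> f u * f1 u - u = c"
    by blast
  then show "\<exists>c. \<forall>u\<in>I. f u * f1 u = u + c" by (metis add.commute diff_add_cancel)
next
  assume "\<exists>c. \<forall>u\<in>I. f u * f1 u = u + c"
  then obtain c where c: "\<And>u. u \<in> I \<Longrightarrow> f u * f1 u - u = c" by auto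
  show "\<forall>u\<in>I. W u = 0"
  proof
    fix u assume u: "u \<in> I"
    have "((\<lambda>u. f u * f1 u - u) has_real_derivative f u * f2 u + f1 u * f1 u - 1) (at u within I)"
      by (auto intro!: derivative_eq_intros meridian_derivs[OF u])
    then have "f u * f2 u + f1 u * f1 u - 1 = 0"
      using constant_real_derivative_zero[OF u] c by blast
    then have "W u * g1 u = 0"
      using meridian_simps(1)[OF u] meridian_frenet[OF u] unfolding W_def by algebra
    then show "W u = 0" using meridian_simps(3)[OF u] by simp
  qed
qed

text \<open>Integrating \<open>f f' = u + c\<close> gives \<open>f^2 = u^2 + 2 c u + d\<close>, and
  unit speed then makes \<open>f g'\<close> constant up to sign, so that \<open>g\<close> is a
  logarithmic antiderivative. Conversely, squaring the formula for \<open>f\<close> and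
  differentiating returns \<open>f f' = u + c\<close>.\<close>

lemma W_zero_iff_explicit:
  "(\<forall>u\<in>I. W u = 0) \<longleftrightarrow>
    (\<exists>a c d s\<^sub>1 s\<^sub>2 :: real. d > c\<^sup>2 \<and> s\<^sub>1 \<in> {1, -1} \<and> s\<^sub>2 \<in> {1, -1} \<and>
       (\<forall>u\<in>I. u\<^sup>2 + 2 * c * u + d \<ge> 0 \<and>
          f u = s\<^sub>1 * sqrt (u\<^sup>2 + 2 * c * u + d) \<and>
          g u = s\<^sub>2 * sqrt (d - c\<^sup>2) * ln \<bar>u + c + sqrt (u\<^sup>2 + 2 * c * u + d)\<bar> + a))"
  (is "_ \<longleftrightarrow> ?R")
proof
  assume "\<forall>u\<in>I. W u = 0"
  then obtain c where c: "\<And>u. u \<in> I \<Longrightarrow> f u * f1 u = u + c"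
    using W_zero_iff by blast
  have "((\<lambda>u. (f u)\<^sup>2 - u\<^sup>2 - 2 * c * u) has_real_derivative 0) (at u within I)" if u: "u \<in> I" for u
    using c[OF u]
    by (auto intro!: derivative_eq_intros meridian_derivs[OF u] simp: algebra_simps)
  then have "\<exists>d. \<forall>u\<in>I. (f u)\<^sup>2 - u\<^sup>2 - 2 * c * u = d"
    by (rule real_derivative_zero_constant)
  then obtain d where d: "\<And>u. u \<in> I \<Longrightarrow> (f u)\<^sup>2 - u\<^sup>2 - 2 * c * u = d"
    by blast
  define q where "q u = u\<^sup>2 + 2 * c * u + d" for u
  have q: "(f u)\<^sup>2 = q u" if "u \<in> I" for u using d[OF that] by (simp add: q_def)
  \<comment> \<open>By unit speed the left side is \<open>f^2 - (f f')^2\<close>, that is,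
    \<open>q u - (u + c)^2\<close>.\<close>
  have fg: "(f u * g1 u)\<^sup>2 = d - c\<^sup>2" if u: "u \<in> I" for u
    using q[OF u] c[OF u] meridian_simps(1)[OF u] unfolding q_def by algebra
  obtain u0 where u0: "u0 \<in> I"
    using nondegenerate_I interior_subset by (fastforce simp: nondegenerate_interval_def)
  have "0 < (f u0 * g1 u0)\<^sup>2" using meridian_simps(2,3)[OF u0] by auto
  then have cd: "d > c\<^sup>2" using fg[OF u0] by simp
  have abs_f: "\<bar>f u\<bar> = sqrt (q u)" if "u \<in> I" for u
    using q[OF that] by (metis real_sqrt_abs)
  have "\<exists>s\<in>{1, -1}. \<forall>u\<in>I. f u = s * sqrt (q u)"
    using continuous_nonzero_sign[OF is_interval_I continuous_derivs(1) meridian_simps(2)]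
  proof
    assume "\<forall>u\<in>I. f u > 0"
    then have "f u = 1 * sqrt (q u)" if "u \<in> I" for u using abs_f[OF that] that by force
    then show ?thesis by blast
  next
    assume "\<forall>u\<in>I. f u < 0"
    then have "f u = - 1 * sqrt (q u)" if "u \<in> I" for u using abs_f[OF that] that by force
    then show ?thesis by blast
  qed
  then obtain s1 where s1: "s1 \<in> {1, -1}" "\<And>u. u \<in> I \<Longrightarrow> f u = s1 * sqrt (q u)" by blast
  \<comment> \<open>\<open>G\<close> is an antiderivative of
    \<open>sqrt (d - c\<^sup>2) / sqrt (q u)\<close>, which is \<open>g1 u\<close> because
    \<open>\<bar>f u\<bar> = sqrt (q u)\<close>.\<close>
  define G where "G u = sqrt (d - c\<^sup>2) * ln (u + c + sqrt (q u))" for u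
  \<comment> \<open>Completing the square shows that \<open>sqrt (q u)\<close> exceeds
    \<open>\<bar>u + c\<bar>\<close>, so the logarithm in \<open>G\<close> has a positive argument
    everywhere.\<close>
  have pos: "q u > 0" "u + c + sqrt (q u) > 0" for u
  proof -
    have "q u = (u + c)\<^sup>2 + (d - c\<^sup>2)" by (simp add: q_def power2_eq_square algebra_simps)
    then have "\<bar>u + c\<bar>\<^sup>2 < q u" using cd by simp
    then have "\<bar>u + c\<bar> < sqrt (q u)" by (rule real_less_rsqrt)
    then show "q u > 0" "u + c + sqrt (q u) > 0"
      by (auto intro: order_le_less_trans[OF zero_le_power2 \<open>\<bar>u + c\<bar>\<^sup>2 < q u\<close>])
  qed
  have "((\<lambda>u. g u - G u) has_real_derivative 0) (at u within I)" if u: "u \<in> I" for u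
  proof -
    have "\<bar>f u\<bar> * g1 u = sqrt (d - c\<^sup>2)"
      using fg[OF u] meridian_simps(3)[OF u] by (metis abs_mult abs_of_pos real_sqrt_abs)
    then have g1: "g1 u = sqrt (d - c\<^sup>2) / sqrt (q u)"
      using pos(1)[of u] abs_f[OF u] by (simp add: field_simps)
    have "(q has_real_derivative 2 * (u + c)) (at u within I)"
      unfolding q_def by (auto intro!: derivative_eq_intros)
    then have D: "((\<lambda>u. u + c + sqrt (q u)) has_real_derivative (1 + (u + c) / sqrt (q u))) (at u within I)"
      using pos(1)[of u] by (auto intro!: derivative_eq_intros simp: field_simps)
    have "(G has_real_derivative
        sqrt (d - c\<^sup>2) * ((1 + (u + c) / sqrt (q u)) / (u + c + sqrt (q u)))) (at u within I)"
      unfolding G_def using DERIV_cmult[OF DERIV_chain2[OF DERIV_ln_divide[OF pos(2)[of u]] D]] by simp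
    moreover have "(1 + (u + c) / sqrt (q u)) / (u + c + sqrt (q u)) = 1 / sqrt (q u)"
    proof -
      have "1 + (u + c) / sqrt (q u) = (u + c + sqrt (q u)) / sqrt (q u)"
        using pos(1)[of u] by (simp add: add_divide_distrib)
      then show ?thesis using pos(2)[of u] by simp
    qed
    ultimately have "(G has_real_derivative g1 u) (at u within I)"
      using g1 by simp
    then show ?thesis
      by (auto intro!: derivative_eq_intros meridian_derivs[OF u])
  qed
  then have "\<exists>a. \<forall>u\<in>I. g u - G u = a"
    by (rule real_derivative_zero_constant)
  then obtain a where a: "\<And>u. u \<in> I \<Longrightarrow> g u - G u = a"
    by blast
  \<comment> \<open>The sign \<open>s\<^sub>2\<close> is 1 because \<open>g1\<close> is positive,
    and the absolute value changes nothing by \<open>pos\<close>.\<close>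
  then have g: "g u = 1 * sqrt (d - c\<^sup>2) * ln \<bar>u + c + sqrt (q u)\<bar> + a" if "u \<in> I" for u
    using a[OF that] pos(2)[of u] by (simp add: G_def)
  have "c\<^sup>2 < d \<and> s1 \<in> {1, - 1} \<and> 1 \<in> {1, - 1 :: real} \<and>
      (\<forall>u\<in>I. 0 \<le> q u \<and> f u = s1 * sqrt (q u) \<and>
        g u = 1 * sqrt (d - c\<^sup>2) * ln \<bar>u + c + sqrt (q u)\<bar> + a)"
    using cd s1 less_imp_le[OF pos(1)] g by blast
  then show ?R
    unfolding q_def by (rule_tac exI)+
next
  assume ?R
  then obtain a c d s s' where s: "s \<in> {1, -1 :: real}"
    and f: "\<forall>u\<in>I. u\<^sup>2 + 2 * c * u + d \<ge> 0 \<and> f u = s * sqrt (u\<^sup>2 + 2 * c * u + d) \<and>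
      g u = s' * sqrt (d - c\<^sup>2) * ln \<bar>u + c + sqrt (u\<^sup>2 + 2 * c * u + d)\<bar> + a"
    by (elim exE conjE) (rule that)
  have eq: "(f u)\<^sup>2 - u\<^sup>2 - 2 * c * u = d" if "u \<in> I" for u
    using f[rule_format, OF that] s by (auto simp: power_mult_distrib)
  have "f u * f1 u = u + c" if u: "u \<in> I" for u
  proof -
    have "((\<lambda>u. (f u)\<^sup>2 - u\<^sup>2 - 2 * c * u) has_real_derivative 2 * (f u * f1 u - u - c)) (at u within I)"
      by (auto intro!: derivative_eq_intros meridian_derivs[OF u] simp: algebra_simps)
    then show ?thesis
      using constant_real_derivative_zero[OF u _ eq] by force
  qed
  then show "\<forall>u\<in>I. W u = 0" using W_zero_iff by blast
qed

section \<open>Constant \<open>W\<close> and the slope equation of case (ii)\<close>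

text \<open>Substituting \<open>g'' = f' \<kappa>\<^sub>m\<close> into the product rule lets
  \<open>f'\<close> factor out.\<close>

lemma f_mult_g1_deriv:
  assumes u: "u \<in> I"
  shows "((\<lambda>u. f u * g1 u) has_real_derivative f1 u * W u) (at u within I)"
proof -
  have "f1 u * W u = f u * g2 u + f1 u * g1 u"
    unfolding W_def meridian_frenet(1)[OF u, symmetric] by (simp add: algebra_simps)
  then show ?thesis
    by (auto intro!: derivative_eq_intros meridian_derivs[OF u])
qed

text \<open>Integrating \<open>f_mult_g1_deriv\<close> gives \<open>f g' = a f + c\<close>. With
  unit speed, \<open>(f f')^2 = f^2 - (a f + c)^2\<close>, and the right side is the slope radicand
  at \<open>f\<close>.\<close>

lemma W_constant_imp_slope_equation:
  assumes W: "\<And>u. u \<in> I \<Longrightarrow> W u = a"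
  shows "\<exists>c. satisfies_slope_equation I f a c"
proof -
  have "((\<lambda>u. f u * g1 u - a * f u) has_real_derivative 0) (at u within I)" if u: "u \<in> I" for u
    using DERIV_diff[OF f_mult_g1_deriv[OF u] DERIV_cmult[OF meridian_derivs(1)[OF u], of a]] W[OF u]
    by (simp add: mult.commute)
  then have "\<exists>c. \<forall>u\<in>I. f u * g1 u - a * f u = c"
    by (rule real_derivative_zero_constant)
  then obtain c where c: "\<And>u. u \<in> I \<Longrightarrow> f u * g1 u - a * f u = c"
    by blast
  have rad: "slope_radicand a c (f u) = (f u * f1 u)\<^sup>2" if u: "u \<in> I" for u
  proof -
    have "f u * g1 u = a * f u + c" using c[OF u] by simp
    moreover have "(f u * f1 u)\<^sup>2 = (f u)\<^sup>2 - (f u * g1 u)\<^sup>2"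
      using meridian_simps(1)[OF u] by algebra
    ultimately show ?thesis
      by (simp add: slope_radicand_def power2_eq_square algebra_simps)
  qed
  \<comment> \<open>The sign is that of \<open>f f'\<close> rather than of \<open>f'\<close>, since
    the slope equation divides by \<open>f\<close>. Where \<open>f'\<close> vanishes so does the
    radicand, and the value 1 there is a mere convention.\<close>
  define s :: "real \<Rightarrow> real" where "s u = (if f u * f1 u \<ge> 0 then 1 else - 1)" for u
  have "s constant_on K"
    if K: "K \<subseteq> I" "is_interval K" and nz: "\<forall>u\<in>K. f1 u \<noteq> 0" for K
  proof -
    have "continuous_on K (\<lambda>u. f u * f1 u)"
      using continuous_derivs K(1) by (auto intro!: continuous_intros elim: continuous_on_subset)
    moreover have "f u * f1 u \<noteq> 0" if "u \<in> K" for u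
      using that nz K(1) meridian_simps(2) by auto
    ultimately have "(\<forall>u\<in>K. f u * f1 u > 0) \<or> (\<forall>u\<in>K. f u * f1 u < 0)"
      using continuous_nonzero_sign[OF K(2)] by blast
    then show "s constant_on K"
    proof
      assume "\<forall>u\<in>K. f u * f1 u > 0"
      then have "\<forall>u\<in>K. s u = 1" by (auto simp: s_def)
      then show ?thesis unfolding constant_on_def by blast
    next
      assume "\<forall>u\<in>K. f u * f1 u < 0"
      then have "\<forall>u\<in>K. s u = -1" by (simp add: s_def not_le)
      then show ?thesis unfolding constant_on_def by blast
    qed
  qed
  moreover have "f1 u = s u * sqrt (slope_radicand a c (f u)) / f u" if "u \<in> I" for u
    using meridian_simps(2)[OF that] by (simp add: rad[OF that] s_def)
  moreover have "s u \<in> {1, -1}" for u by (simp add: s_def)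
  ultimately show ?thesis
    unfolding satisfies_slope_equation_def
    by (intro exI[of _ c] exI[of _ s]) (auto simp: rad)
qed

text \<open>\<open>W\<close> contains second derivatives, so third derivatives enter. The result
  serves to treat zeros of \<open>f'\<close> below.\<close>

lemma W_differentiable:
  assumes u: "u \<in> I"
  obtains D where "(W has_real_derivative D) (at u within I)"
proof -
  have "(f2 has_real_derivative deriv_within I f2 u) (at u within I)"
    "(g2 has_real_derivative deriv_within I g2 u) (at u within I)"
    using u meridian_curve
    by (auto simp: meridian_curve_def has_real_derivative_iff_has_vector_derivative
        intro!: smooth_on_interval_has_vector_derivative smooth_on_interval_deriv_within)
  note [derivative_intros] = this meridian_derivs[OF u]
  show ?thesis
    by (rule that, unfold W_def[abs_def] meridian_curvature_def)
      (rule derivative_intros refl | assumption)+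
qed

text \<open>Squaring the slope equation gives \<open>(f g')^2 = (a f + c)^2\<close>. Taking the root
  with one sign \<open>\<epsilon>\<close> and differentiating gives
  \<open>f' (W - \<epsilon> a) = 0\<close>, which settles all points with
  \<open>f' \<noteq> 0\<close>.\<close>

lemma slope_equation_imp_W_constant:
  assumes slope: "satisfies_slope_equation I f a c" and \<kappa>\<^sub>m: "\<And>u. u \<in> I \<Longrightarrow> \<kappa>\<^sub>m u \<noteq> 0"
  obtains b where "\<And>u. u \<in> I \<Longrightarrow> W u = b"
proof -
  have sq: "(f u * g1 u)\<^sup>2 = (a * f u + c)\<^sup>2" if u: "u \<in> I" for u
  proof -
    obtain s :: real where s: "s \<in> {1, -1}" "slope_radicand a c (f u) \<ge> 0"
      "f1 u = s * sqrt (slope_radicand a c (f u)) / f u"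
      using slope u unfolding satisfies_slope_equation_def by meson
    then have "f u * f1 u = s * sqrt (slope_radicand a c (f u))"
      using meridian_simps(2)[OF u] by (simp add: field_simps)
    then have "(f u * f1 u)\<^sup>2 = slope_radicand a c (f u)"
      using s(1,2) by (auto simp: power_mult_distrib)
    then show ?thesis
      using meridian_simps(1)[OF u] unfolding slope_radicand_def by algebra
  qed
  \<comment> \<open>Neither \<open>f g'\<close> nor \<open>a f + c\<close> changes sign on \<open>I\<close>, so the square root can be taken with one global sign.\<close>
  have nz: "a * f u + c \<noteq> 0" if "u \<in> I" for u
    using sq[OF that] meridian_simps(2,3)[OF that] by auto
  define r where "r u = f u * g1 u / (a * f u + c)" for u
  have r: "r u = 1 \<or> r u = -1" if "u \<in> I" for u
  proof -
    have "f u * g1 u = a * f u + c \<or> f u * g1 u = - (a * f u + c)"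
      using sq[OF that] by (simp only: power2_eq_iff)
    then show ?thesis
      using nz[OF that] unfolding r_def by (metis divide_minus_left divide_self)
  qed
  have "continuous_on I r"
    unfolding r_def using continuous_derivs nz by (intro continuous_intros) auto
  then have "(\<forall>u\<in>I. r u > 0) \<or> (\<forall>u\<in>I. r u < 0)"
    using r by (intro continuous_nonzero_sign[OF is_interval_I]) fastforce+
  then have "(\<forall>u\<in>I. r u = 1) \<or> (\<forall>u\<in>I. r u = -1)"
  proof (elim disjE)
    assume pos: "\<forall>u\<in>I. r u > 0"
    have "r u = 1" if "u \<in> I" for u using pos[rule_format, OF that] r[OF that] by linarith
    then show ?thesis by blast
  next
    assume neg: "\<forall>u\<in>I. r u < 0"
    have "r u = -1" if "u \<in> I" for u using neg[rule_format, OF that] r[OF that] by linarith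
    then show ?thesis by blast
  qed
  then obtain \<epsilon> where "\<forall>u\<in>I. r u = \<epsilon>" by blast
  then have \<epsilon>: "f u * g1 u / (a * f u + c) = \<epsilon>" if "u \<in> I" for u
    using that by (simp add: r_def)
  have eq: "f u * g1 u - \<epsilon> * (a * f u + c) = 0" if "u \<in> I" for u
    using \<epsilon>[OF that] nz[OF that] by (simp add: field_simps)
  have *: "f1 u * (W u - \<epsilon> * a) = 0" if u: "u \<in> I" for u
  proof -
    have "((\<lambda>u. f u * g1 u - \<epsilon> * (a * f u + c)) has_real_derivative f1 u * (W u - \<epsilon> * a)) (at u within I)"
      by (rule derivative_eq_intros f_mult_g1_deriv[OF u] meridian_derivs(1)[OF u] refl)+
        (simp add: algebra_simps)
    then show ?thesis by (rule constant_real_derivative_zero[OF u _ eq])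
  qed
  \<comment> \<open>At a zero of \<open>f'\<close> the relation
    \<open>f' (W - \<epsilon> a) = 0\<close> says nothing, so it is differentiated once more. There
    \<open>f'' (W - \<epsilon> a) = 0\<close>, and \<open>f'' = - g' \<kappa>\<^sub>m\<close> does
    not vanish.\<close>
  have "W u = \<epsilon> * a" if u: "u \<in> I" for u
  proof -
    obtain D where "(W has_real_derivative D) (at u within I)"
      using W_differentiable[OF u] by blast
    then have "((\<lambda>u. f1 u * (W u - \<epsilon> * a)) has_real_derivative f1 u * D + f2 u * (W u - \<epsilon> * a))
        (at u within I)"
      by (auto intro!: derivative_eq_intros meridian_derivs(2)[OF u])
    then have "f1 u * D + f2 u * (W u - \<epsilon> * a) = 0"
      using constant_real_derivative_zero[OF u, of "\<lambda>u. f1 u * (W u - \<epsilon> * a)"] * by blast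
    moreover have "f2 u \<noteq> 0 \<or> f1 u \<noteq> 0"
      using meridian_frenet(2)[OF u] meridian_simps(3)[OF u] \<kappa>\<^sub>m[OF u] by force
    ultimately show ?thesis
      using *[OF u] by (cases "f1 u = 0") auto
  qed
  then show ?thesis using that by blast
qed

end


subsection \<open>The spherical curve\<close>

locale curve_on_sphere2 =
  fixes J :: "real set" and l n :: "real \<Rightarrow> real^4"
  assumes spherical_curve: "spherical_curve_with_normal J l n"
begin

abbreviation "t \<equiv> deriv_within J l"
abbreviation "t' \<equiv> deriv_within J t"
abbreviation "n' \<equiv> deriv_within J n"
abbreviation "\<kappa> \<equiv> spherical_curvature J l n"
abbreviation "e4 \<equiv> (axis 4 1 :: real^4)"

lemma nondegenerate_J: "nondegenerate_interval J"
  using spherical_curve by (simp add: spherical_curve_with_normal_def)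

lemma convex_J: "convex J"
  using nondegenerate_J by (simp add: nondegenerate_interval_def is_interval_convex_1)

lemma curve_derivs:
  assumes "v \<in> J"
  shows "(l has_vector_derivative t v) (at v within J)"
    and "(t has_vector_derivative t' v) (at v within J)"
    and "(n has_vector_derivative n' v) (at v within J)"
  using assms spherical_curve
  by (auto simp: spherical_curve_with_normal_def
      intro!: smooth_on_interval_has_vector_derivative smooth_on_interval_deriv_within)

text \<open>Product rule for a constant inner product. It yields all the Frenet relations of the
  frame.\<close>

lemma inner_constant_derivative:
  assumes v: "v \<in> J" and "(x has_vector_derivative x') (at v within J)"
    "(y has_vector_derivative y') (at v within J)" and "\<And>v. v \<in> J \<Longrightarrow> x v \<bullet> y v = k"
  shows "x v \<bullet> y' + x' \<bullet> y v = 0"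
  using constant_vector_derivative_zero[OF nondegenerate_J v has_vector_derivative_inner[OF assms(2,3)] assms(4)] .

lemma frame_l_n:
  assumes "v \<in> J"
  shows "l v \<bullet> l v = 1" "n v \<bullet> n v = 1" "t v \<bullet> t v = 1" "l v \<bullet> n v = 0" "n v \<bullet> t v = 0"
    "l v \<bullet> e4 = 0" "n v \<bullet> e4 = 0"
  using assms spherical_curve
  by (auto simp: spherical_curve_with_normal_def sphere2_iff span_e123_iff norm_eq_1 inner_axis
      inner_commute)

text \<open>Each relation comes from differentiating an orthonormality relation of \<open>t\<close>,
  \<open>n\<close>, \<open>l\<close>, \<open>e4\<close>.\<close>

lemma frame_orthonormal:
  assumes v: "v \<in> J"
  shows "t v \<bullet> l v = 0" "t v \<bullet> e4 = 0" "t' v \<bullet> e4 = 0" "n' v \<bullet> e4 = 0" "n' v \<bullet> n v = 0"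
    "t' v \<bullet> t v = 0" "n' v \<bullet> l v = 0" "t' v \<bullet> l v = - 1" "n' v \<bullet> t v = - \<kappa> v"
proof -
  note c = has_vector_derivative_const[of e4]
  note d = curve_derivs
  \<comment> \<open>Both \<open>tl\<close> and \<open>t4\<close> are stated on all of
    \<open>J\<close> because they are differentiated again below.\<close>
  have tl: "t v \<bullet> l v = 0" if "v \<in> J" for v
    using inner_constant_derivative[OF that d(1)[OF that] d(1)[OF that] frame_l_n(1)]
    by (simp add: inner_commute)
  have t4: "t v \<bullet> e4 = 0" if "v \<in> J" for v
    using inner_constant_derivative[OF that d(1)[OF that] c frame_l_n(6)] by simp
  show "t v \<bullet> l v = 0" "t v \<bullet> e4 = 0" using tl t4 v by auto
  show "t' v \<bullet> e4 = 0"
    using inner_constant_derivative[OF v d(2)[OF v] c t4] by simp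
  show "n' v \<bullet> e4 = 0"
    using inner_constant_derivative[OF v d(3)[OF v] c frame_l_n(7)] by simp
  show "n' v \<bullet> n v = 0"
    using inner_constant_derivative[OF v d(3)[OF v] d(3)[OF v] frame_l_n(2)]
    by (simp add: inner_commute)
  show "t' v \<bullet> t v = 0"
    using inner_constant_derivative[OF v d(2)[OF v] d(2)[OF v] frame_l_n(3)]
    by (simp add: inner_commute)
  show "n' v \<bullet> l v = 0"
    using inner_constant_derivative[OF v d(1)[OF v] d(3)[OF v] frame_l_n(4)] frame_l_n[OF v]
    by (simp add: inner_commute)
  show "t' v \<bullet> l v = - 1"
    using inner_constant_derivative[OF v d(2)[OF v] d(1)[OF v] tl] frame_l_n[OF v]
    by simp
  show "n' v \<bullet> t v = - \<kappa> v"
    using inner_constant_derivative[OF v d(3)[OF v] d(2)[OF v] frame_l_n(5)]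
    by (simp add: spherical_curvature_def inner_commute)
qed

text \<open>In the frame expansion of \<open>n'\<close> only the component along \<open>t\<close>
  survives.\<close>

lemma n_deriv_eq:
  assumes v: "v \<in> J"
  shows "n' v = - \<kappa> v *\<^sub>R t v"
  using orthonormal_frame_expand[of "t v" "n v" "l v" e4 "n' v"]
    frame_l_n[OF v] frame_orthonormal[OF v]
  by (simp add: inner_commute inner_axis_axis)

text \<open>The vector \<open>b l + n\<close> is constant and spans the axis of the circle.\<close>

lemma constant_curvature_imp_circle:
  assumes b: "\<And>v. v \<in> J \<Longrightarrow> \<kappa> v = b"
  shows "\<exists>C. circle_on_sphere2 C \<and> l ` J \<subseteq> C"
proof -
  \<comment> \<open>This will be the length of the axis vector \<open>b l + n\<close>, since
    \<open>l\<close> and \<open>n\<close> are orthonormal. The plane of the circle then has height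
    \<open>b / r\<close>.\<close>
  define r where "r = sqrt (1 + b\<^sup>2)"
  have r: "r > 0" "r * r = 1 + b\<^sup>2"
    unfolding r_def by (auto intro: add_pos_nonneg)
  have "((\<lambda>v. b *\<^sub>R l v + n v) has_vector_derivative 0) (at v within J)" if v: "v \<in> J" for v
    using n_deriv_eq[OF v] b[OF v]
    by (auto intro!: derivative_eq_intros curve_derivs[OF v])
  then obtain w where w: "\<And>v. v \<in> J \<Longrightarrow> b *\<^sub>R l v + n v = w"
    using has_derivative_zero_constant[OF convex_J, of "\<lambda>v. b *\<^sub>R l v + n v"]
    by (auto simp: has_vector_derivative_def)
  obtain v0 where v0: "v0 \<in> J"
    using nondegenerate_J interior_subset by (fastforce simp: nondegenerate_interval_def)
  have ww: "w \<bullet> w = r * r" "w \<bullet> e4 = 0"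
    using frame_l_n[OF v0] unfolding w[OF v0, symmetric] r(2)
    by (simp_all add: algebra_simps inner_commute power2_eq_square)
  have "norm w = r" using ww(1) r(1) by (simp add: norm_eq_sqrt_inner)
  then have "norm (w /\<^sub>R r) = 1" using r(1) by simp
  moreover have "w /\<^sub>R r \<in> span_e123"
    using ww(2) by (simp add: span_e123_iff inner_axis)
  moreover have "\<bar>b / r\<bar> < 1"
  proof -
    have "\<bar>b\<bar> < r" unfolding r_def by (rule real_less_rsqrt) simp
    then show ?thesis using r(1) by simp
  qed
  moreover have "l v \<bullet> (w /\<^sub>R r) = b / r" if "v \<in> J" for v
    using frame_l_n[OF that] unfolding w[OF that, symmetric]
    by (simp add: algebra_simps divide_inverse)
  moreover have "l v \<in> sphere2" if "v \<in> J" for v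
    using frame_l_n[OF that] by (simp add: sphere2_iff)
  ultimately show ?thesis
    unfolding circle_on_sphere2_def
    by (intro exI[of _ "{x \<in> sphere2. x \<bullet> (w /\<^sub>R r) = b / r}"] conjI exI[of _ "w /\<^sub>R r"]
        exI[of _ "b / r"]) auto
qed

end


subsection \<open>The geometry of the surface\<close>

text \<open>Chain rule along the projection, whose image of \<open>I \<times> J\<close> lies in
  \<open>I\<close>.\<close>

lemma has_derivative_fst_factor:
  fixes h :: "real \<Rightarrow> 'a::real_normed_vector"
  assumes "(h has_vector_derivative h') (at (fst p) within I)" "p \<in> I \<times> J"
  shows "((\<lambda>q. h (fst q)) has_derivative (\<lambda>\<xi>. fst \<xi> *\<^sub>R h')) (at p within I \<times> J)"
proof -
  have "(h has_derivative (\<lambda>x. x *\<^sub>R h')) (at (fst p) within fst ` (I \<times> J))"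
    using assms unfolding has_vector_derivative_def by (auto intro: has_derivative_subset)
  then show ?thesis
    using has_derivative_in_compose[OF has_derivative_fst[OF has_derivative_ident]] by blast
qed

lemma has_derivative_snd_factor:
  fixes h :: "real \<Rightarrow> 'a::real_normed_vector"
  assumes "(h has_vector_derivative h') (at (snd p) within J)" "p \<in> I \<times> J"
  shows "((\<lambda>q. h (snd q)) has_derivative (\<lambda>\<xi>. snd \<xi> *\<^sub>R h')) (at p within I \<times> J)"
proof -
  have "(h has_derivative (\<lambda>x. x *\<^sub>R h')) (at (snd p) within snd ` (I \<times> J))"
    using assms unfolding has_vector_derivative_def by (auto intro: has_derivative_subset)
  then show ?thesis
    using has_derivative_in_compose[OF has_derivative_snd[OF has_derivative_ident]] by blast
qed

locale meridian_surface_in_R4 = meridian I f g + curve_on_sphere2 J l n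
  for I J :: "real set" and f g :: "real \<Rightarrow> real" and l n :: "real \<Rightarrow> real^4"
begin

abbreviation "S \<equiv> I \<times> J"
abbreviation "z \<equiv> meridian_surface f g l"

definition X :: "real \<times> real \<Rightarrow> real^4" where
  "X p = f1 (fst p) *\<^sub>R l (snd p) + g1 (fst p) *\<^sub>R e4"

text \<open>The unit normal \<open>(- g1, f1)\<close> of the meridian, carried into the plane of
  \<open>l\<close> and \<open>e4\<close>.\<close>

definition N :: "real \<times> real \<Rightarrow> real^4" where
  "N p = - g1 (fst p) *\<^sub>R l (snd p) + f1 (fst p) *\<^sub>R e4"

lemma has_derivative_factors:
  assumes "p \<in> S"
  shows "((\<lambda>q. f (fst q)) has_derivative (\<lambda>\<xi>. fst \<xi> * f1 (fst p))) (at p within S)"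
    and "((\<lambda>q. f1 (fst q)) has_derivative (\<lambda>\<xi>. fst \<xi> * f2 (fst p))) (at p within S)"
    and "((\<lambda>q. g (fst q)) has_derivative (\<lambda>\<xi>. fst \<xi> * g1 (fst p))) (at p within S)"
    and "((\<lambda>q. g1 (fst q)) has_derivative (\<lambda>\<xi>. fst \<xi> * g2 (fst p))) (at p within S)"
    and "((\<lambda>q. l (snd q)) has_derivative (\<lambda>\<xi>. snd \<xi> *\<^sub>R t (snd p))) (at p within S)"
    and "((\<lambda>q. t (snd q)) has_derivative (\<lambda>\<xi>. snd \<xi> *\<^sub>R t' (snd p))) (at p within S)"
    and "((\<lambda>q. n (snd q)) has_derivative (\<lambda>\<xi>. snd \<xi> *\<^sub>R n' (snd p))) (at p within S)"
  using assms meridian_derivs[of "fst p"] curve_derivs[of "snd p"]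
    has_derivative_fst_factor[OF _ assms] has_derivative_snd_factor[OF _ assms]
  by (auto simp: has_real_derivative_iff_has_vector_derivative mem_Times_iff simp flip: real_scaleR_def)

lemma frame:
  assumes "p \<in> S"
  shows "X p \<bullet> X p = 1" "N p \<bullet> N p = 1" "X p \<bullet> N p = 0"
    "X p \<bullet> t (snd p) = 0" "X p \<bullet> n (snd p) = 0" "N p \<bullet> t (snd p) = 0" "N p \<bullet> n (snd p) = 0"
  using assms frame_l_n[of "snd p"] frame_orthonormal[of "snd p"] meridian_simps(1)[of "fst p"]
  by (auto simp: X_def N_def mem_Times_iff inner_axis_axis algebra_simps inner_commute)

lemma expand:
  assumes p: "p \<in> S"
  shows "x = (x \<bullet> X p) *\<^sub>R X p + (x \<bullet> t (snd p)) *\<^sub>R t (snd p) +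
    (x \<bullet> n (snd p)) *\<^sub>R n (snd p) + (x \<bullet> N p) *\<^sub>R N p"
  using p frame[OF p] frame_l_n[of "snd p"]
  by (intro orthonormal_frame_expand) (auto simp: inner_commute)

section \<open>Tangent plane, second fundamental form and mean curvature\<close>

lemma differential_eq:
  assumes "p \<in> S" "(w has_derivative w') (at p within S)"
  shows "differential S w p = w'"
  using frechet_derivative_on_product[OF nondegenerate_I nondegenerate_J assms] .

lemma differential_z:
  assumes p: "p \<in> S"
  shows "differential S z p = (\<lambda>\<xi>. fst \<xi> *\<^sub>R X p + (snd \<xi> * f (fst p)) *\<^sub>R t (snd p))"
proof (rule differential_eq[OF p])
  show "(z has_derivative (\<lambda>\<xi>. fst \<xi> *\<^sub>R X p + (snd \<xi> * f (fst p)) *\<^sub>R t (snd p))) (at p within S)"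
    unfolding meridian_surface_def case_prod_beta X_def
    by (auto intro!: derivative_eq_intros has_derivative_factors[OF p] simp: algebra_simps)
qed

lemma tangent_space_z:
  assumes p: "p \<in> S"
  shows "tangent_space S z p = span {X p, t (snd p)}"
proof -
  \<comment> \<open>Here \<open>f \<noteq> 0\<close> makes \<open>z\<close> an immersion: the
    \<open>v\<close> direction has derivative \<open>f t\<close>, so the parameter
    \<open>y / f\<close> is needed to reach \<open>y t\<close>.\<close>
  have "x *\<^sub>R X p + y *\<^sub>R t (snd p) \<in> tangent_space S z p" for x y
    using meridian_simps(2)[of "fst p"] p unfolding tangent_space_def differential_z[OF p]
    by (intro range_eqI[of _ _ "(x, y / f (fst p))"]) auto
  note mem = this
  show ?thesis
  proof
    show "tangent_space S z p \<subseteq> span {X p, t (snd p)}"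
      unfolding tangent_space_def differential_z[OF p]
      by (intro image_subsetI span_add span_scale span_base) simp_all
    show "span {X p, t (snd p)} \<subseteq> tangent_space S z p"
    proof
      fix w assume "w \<in> span {X p, t (snd p)}"
      then obtain x y where "w - x *\<^sub>R X p = y *\<^sub>R t (snd p)"
        by (auto simp: span_insert)
      then have "w = x *\<^sub>R X p + y *\<^sub>R t (snd p)" by (simp add: algebra_simps)
      then show "w \<in> tangent_space S z p" using mem by simp
    qed
  qed
qed

lemma normal_space_z_iff:
  assumes p: "p \<in> S"
  shows "y \<in> Defs.normal_space S z p \<longleftrightarrow> y \<bullet> X p = 0 \<and> y \<bullet> t (snd p) = 0"
proof
  assume "y \<in> Defs.normal_space S z p"
  then have "\<forall>w\<in>span {X p, t (snd p)}. w \<bullet> y = 0"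
    by (simp add: Defs.normal_space_def tangent_space_z[OF p] orthogonal_comp_def orthogonal_def)
  then show "y \<bullet> X p = 0 \<and> y \<bullet> t (snd p) = 0"
    by (metis inner_commute insertCI span_base)
next
  assume y: "y \<bullet> X p = 0 \<and> y \<bullet> t (snd p) = 0"
  have "orthogonal y w" if "w \<in> span {X p, t (snd p)}" for w
    using y by (intro orthogonal_to_span[OF that]) (auto simp: orthogonal_def)
  then show "y \<in> Defs.normal_space S z p"
    by (auto simp: Defs.normal_space_def tangent_space_z[OF p] orthogonal_comp_def orthogonal_commute)
qed

lemma normal_part_z:
  assumes p: "p \<in> S"
  shows "normal_part S z p x = (x \<bullet> n (snd p)) *\<^sub>R n (snd p) + (x \<bullet> N p) *\<^sub>R N p"
proof (rule normal_part_eqI)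
  show "subspace (tangent_space S z p)" by (simp add: tangent_space_z[OF p])
  show "(x \<bullet> n (snd p)) *\<^sub>R n (snd p) + (x \<bullet> N p) *\<^sub>R N p \<in> Defs.normal_space S z p"
    using frame[OF p] frame_l_n[of "snd p"] p
    by (auto simp: normal_space_z_iff[OF p] algebra_simps inner_commute)
  have "x - ((x \<bullet> n (snd p)) *\<^sub>R n (snd p) + (x \<bullet> N p) *\<^sub>R N p)
    = (x \<bullet> X p) *\<^sub>R X p + (x \<bullet> t (snd p)) *\<^sub>R t (snd p)"
    using expand[OF p, of x] by (simp add: algebra_simps)
  then show "x - ((x \<bullet> n (snd p)) *\<^sub>R n (snd p) + (x \<bullet> N p) *\<^sub>R N p) \<in> tangent_space S z p"
    by (simp add: tangent_space_z[OF p] span_add span_scale span_base)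
qed

lemma normal_part_eq_zero_iff:
  assumes p: "p \<in> S"
  shows "normal_part S z p x = 0 \<longleftrightarrow> x \<bullet> n (snd p) = 0 \<and> x \<bullet> N p = 0"
proof
  assume "normal_part S z p x = 0"
  then have *: "(x \<bullet> n (snd p)) *\<^sub>R n (snd p) + (x \<bullet> N p) *\<^sub>R N p = 0"
    by (simp add: normal_part_z[OF p])
  from arg_cong[OF *, of "\<lambda>y. y \<bullet> n (snd p)"] arg_cong[OF *, of "\<lambda>y. y \<bullet> N p"]
  show "x \<bullet> n (snd p) = 0 \<and> x \<bullet> N p = 0"
    using frame[OF p] frame_l_n[of "snd p"] p by (auto simp: algebra_simps inner_commute)
qed (simp add: normal_part_z[OF p])

lemma differential_differential_z:
  assumes p: "p \<in> S"
  shows "differential S (\<lambda>q. differential S z q \<eta>) p \<xi> =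
    fst \<xi> *\<^sub>R (fst \<eta> *\<^sub>R (f2 (fst p) *\<^sub>R l (snd p) + g2 (fst p) *\<^sub>R e4)
      + (snd \<eta> * f1 (fst p)) *\<^sub>R t (snd p))
    + snd \<xi> *\<^sub>R ((fst \<eta> * f1 (fst p)) *\<^sub>R t (snd p) + (snd \<eta> * f (fst p)) *\<^sub>R t' (snd p))"
    (is "_ = ?D \<xi>")
proof -
  have "((\<lambda>q. fst \<eta> *\<^sub>R X q + (snd \<eta> * f (fst q)) *\<^sub>R t (snd q)) has_derivative ?D) (at p within S)"
    unfolding X_def
    by (auto intro!: derivative_eq_intros has_derivative_factors[OF p] simp: algebra_simps)
  \<comment> \<open>\<open>differential_z\<close> is available only at points of \<open>S\<close>,
    which is enough for a derivative within \<open>S\<close>.\<close>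
  then have "((\<lambda>q. differential S z q \<eta>) has_derivative ?D) (at p within S)"
    by (rule has_derivative_transform[OF p, rotated]) (simp add: differential_z)
  from differential_eq[OF p this] show ?thesis by simp
qed

text \<open>The parameters are orthogonal with \<open>E = 1\<close>, \<open>F = 0\<close>,
  \<open>G = f^2\<close>, so the mixed term drops out of the trace. The rest comes from the normal
  parts of \<open>f'' l + g'' e4\<close> and \<open>f t'\<close>.\<close>

lemma mean_curvature_vector_z:
  assumes p: "p \<in> S"
  shows "mean_curvature_vector S z p =
    (1 / (2 * f (fst p))) *\<^sub>R (\<kappa> (snd p) *\<^sub>R n (snd p) + W (fst p) *\<^sub>R N p)"
proof -
  have uv: "fst p \<in> I" "snd p \<in> J" using p by auto
  note inn = frame_l_n[OF uv(2)] frame_orthonormal[OF uv(2)] frame[OF p]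
  have forms: "first_form S z p (1, 0) (1, 0) = 1" "first_form S z p (1, 0) (0, 1) = 0"
    "first_form S z p (0, 1) (0, 1) = (f (fst p))\<^sup>2"
    using inn by (auto simp: first_form_def differential_z[OF p] power2_eq_square)
  have uu: "second_form S z p (1, 0) (1, 0) = \<kappa>\<^sub>m (fst p) *\<^sub>R N p"
    using inn unfolding second_form_def normal_part_z[OF p] differential_differential_z[OF p]
    by (simp add: N_def algebra_simps inner_commute inner_axis_axis meridian_curvature_def)
  have tN: "t' (snd p) \<bullet> N p = g1 (fst p)"
    using inn by (simp add: N_def algebra_simps)
  have vv: "second_form S z p (0, 1) (0, 1) =
      (f (fst p) * \<kappa> (snd p)) *\<^sub>R n (snd p) + (f (fst p) * g1 (fst p)) *\<^sub>R N p"
    using tN unfolding second_form_def normal_part_z[OF p] differential_differential_z[OF p]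
    by (simp add: spherical_curvature_def)
  \<comment> \<open>The numerator of the trace contains a factor \<open>f\<close>, which cancels one
    factor of \<open>E G - F^2 = f^2\<close>.\<close>
  have "(f (fst p))\<^sup>2 *\<^sub>R \<kappa>\<^sub>m (fst p) *\<^sub>R N p
      + ((f (fst p) * \<kappa> (snd p)) *\<^sub>R n (snd p) + (f (fst p) * g1 (fst p)) *\<^sub>R N p)
    = f (fst p) *\<^sub>R (\<kappa> (snd p) *\<^sub>R n (snd p) + W (fst p) *\<^sub>R N p)"
    by (simp add: W_def algebra_simps power2_eq_square)
  then show ?thesis
    using meridian_simps(2)[OF uv(1)]
    unfolding mean_curvature_vector_def forms uu vv Let_def by (simp add: power2_eq_square)
qed

section \<open>Parallel normal fields and the criterion \<open>W = \<mu> \<kappa>\<close>\<close>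

text \<open>By the Frenet formulas of the meridian both partial derivatives of \<open>N\<close> are
  tangential, which is why \<open>N\<close> is parallel.\<close>

lemma N_has_derivative:
  assumes p: "p \<in> S"
  shows "(N has_derivative (\<lambda>\<xi>. (- fst \<xi> * \<kappa>\<^sub>m (fst p)) *\<^sub>R X p - (snd \<xi> * g1 (fst p)) *\<^sub>R t (snd p)))
    (at p within S)"
proof -
  have f2: "f2 (fst p) = - \<kappa>\<^sub>m (fst p) * g1 (fst p)" and g2: "g2 (fst p) = \<kappa>\<^sub>m (fst p) * f1 (fst p)"
    using meridian_frenet[of "fst p"] p by (auto simp: algebra_simps)
  show ?thesis
    unfolding N_def[abs_def] X_def
    by (rule derivative_eq_intros has_derivative_factors[OF p] refl)+
      (simp add: f2 g2 fun_eq_iff algebra_simps)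
qed

text \<open>By \<open>n_deriv_eq\<close> the derivative of \<open>n\<close> is tangential, so
  \<open>n\<close> is parallel too.\<close>

lemma n_has_derivative:
  assumes p: "p \<in> S"
  shows "((\<lambda>q. n (snd q)) has_derivative (\<lambda>\<xi>. (- snd \<xi> * \<kappa> (snd p)) *\<^sub>R t (snd p)))
    (at p within S)"
  using has_derivative_factors(7)[OF p] n_deriv_eq[of "snd p"] p by auto

text \<open>\<open>n\<close> and \<open>N\<close> are parallel, so a parallel normal field has constant components.\<close>

lemma parallel_imp_constant_components:
  assumes diff: "\<nu> differentiable_on S"
    and normal: "\<And>p. p \<in> S \<Longrightarrow> \<nu> p \<in> Defs.normal_space S z p"
    and parallel: "\<And>p \<xi>. p \<in> S \<Longrightarrow> normal_connection S z \<nu> p \<xi> = 0"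
  shows "\<exists>\<alpha> \<beta>. \<forall>p\<in>S. \<nu> p \<bullet> n (snd p) = \<alpha> \<and> \<nu> p \<bullet> N p = \<beta>"
proof -
  have "((\<lambda>p. \<nu> p \<bullet> n (snd p)) has_derivative (\<lambda>_. 0)) (at p within S)"
    "((\<lambda>p. \<nu> p \<bullet> N p) has_derivative (\<lambda>_. 0)) (at p within S)" if p: "p \<in> S" for p
  proof -
    obtain \<nu>' where \<nu>': "(\<nu> has_derivative \<nu>') (at p within S)"
      using diff p by (auto simp: differentiable_on_def differentiable_def)
    have orth: "\<nu>' \<xi> \<bullet> n (snd p) = 0" "\<nu>' \<xi> \<bullet> N p = 0" for \<xi>
      using parallel[OF p, of \<xi>]
      by (simp_all add: normal_connection_def differential_eq[OF p \<nu>'] normal_part_eq_zero_iff[OF p])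
    have tangential: "\<nu> p \<bullet> X p = 0" "\<nu> p \<bullet> t (snd p) = 0"
      using normal[OF p] by (simp_all add: normal_space_z_iff[OF p])
    \<comment> \<open>In the product rule, \<open>\<nu>\<close> is normal and so kills the
      tangential derivative of \<open>n\<close>, while \<open>\<nu>'\<close> has no normal part. The
      same argument applies to \<open>N\<close>.\<close>
    show "((\<lambda>p. \<nu> p \<bullet> n (snd p)) has_derivative (\<lambda>_. 0)) (at p within S)"
      using has_derivative_inner[OF \<nu>' n_has_derivative[OF p]] orth tangential
      by (simp add: inner_diff_right)
    show "((\<lambda>p. \<nu> p \<bullet> N p) has_derivative (\<lambda>_. 0)) (at p within S)"
      using has_derivative_inner[OF \<nu>' N_has_derivative[OF p]] orth tangential
      by (simp add: inner_diff_right)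
  qed
  moreover have "convex S" using convex_I convex_J by (rule convex_Times)
  ultimately show ?thesis
    using has_derivative_zero_constant[of S "\<lambda>p. \<nu> p \<bullet> n (snd p)"]
      has_derivative_zero_constant[of S "\<lambda>p. \<nu> p \<bullet> N p"] by blast
qed

text \<open>Collinearity with the mean curvature vector puts the components of \<open>\<b>\<close>
  along \<open>n\<close> and \<open>N\<close> in the ratio \<open>\<kappa> : W\<close>. Since
  \<open>\<b>\<close> is parallel, these components are constants \<open>\<alpha>\<close>,
  \<open>\<beta>\<close>, so the ratio is the same at all points.\<close>

lemma parallel_imp_proportional:
  assumes par: "parallel_normal_bundle S z" and \<kappa>: "\<And>v. v \<in> J \<Longrightarrow> \<kappa> v \<noteq> 0"
  shows "\<exists>\<mu>. \<forall>u\<in>I. \<forall>v\<in>J. W u = \<mu> * \<kappa> v"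
proof -
  obtain \<b> \<l> where frame': "geometric_normal_frame S z \<b> \<l>"
    and parallel: "\<And>p \<xi>. p \<in> S \<Longrightarrow> normal_connection S z \<b> p \<xi> = 0"
    using par unfolding parallel_normal_bundle_def by blast
  have "\<exists>\<alpha> \<beta>. \<forall>p\<in>S. \<b> p \<bullet> n (snd p) = \<alpha> \<and> \<b> p \<bullet> N p = \<beta>"
    using frame' parallel
    by (intro parallel_imp_constant_components) (auto simp: geometric_normal_frame_def)
  then obtain \<alpha> \<beta> where \<alpha>\<beta>: "\<And>p. p \<in> S \<Longrightarrow> \<b> p \<bullet> n (snd p) = \<alpha> \<and> \<b> p \<bullet> N p = \<beta>" by blast
  have "W u = (\<beta> / \<alpha>) * \<kappa> v" if uv: "u \<in> I" "v \<in> J" for u v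
  proof -
    let ?p = "(u, v)"
    have p: "?p \<in> S" using uv by simp
    have "mean_curvature_vector S z ?p \<noteq> 0" "\<b> ?p \<noteq> 0"
      "collinear {0, mean_curvature_vector S z ?p, \<b> ?p}"
      using frame' p unfolding geometric_normal_frame_def by force+
    then obtain k where k: "\<b> ?p = k *\<^sub>R mean_curvature_vector S z ?p" "k \<noteq> 0"
      unfolding collinear_lemma by auto
    define r where "r = k * (1 / (2 * f u))"
    have r: "r \<noteq> 0" using k(2) meridian_simps(2)[OF uv(1)] by (simp add: r_def)
    have b: "\<b> ?p = r *\<^sub>R (\<kappa> v *\<^sub>R n v + W u *\<^sub>R N ?p)"
      by (simp add: k(1) mean_curvature_vector_z[OF p] r_def)
    have "\<b> ?p \<bullet> n v = r * \<kappa> v" "\<b> ?p \<bullet> N ?p = r * W u"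
      using frame[OF p] frame_l_n[OF uv(2)] unfolding b
      by (simp_all add: inner_add_left inner_add_right inner_commute)
    \<comment> \<open>Since \<open>r\<close> and \<open>\<kappa> v\<close> are nonzero, so is
      \<open>\<alpha>\<close>, and the point-dependent factor \<open>r\<close> cancels from
      \<open>\<beta> / \<alpha>\<close>.\<close>
    then have "\<alpha> = r * \<kappa> v" "\<beta> = r * W u"
      using \<alpha>\<beta>[OF p] by simp_all
    then show ?thesis using r \<kappa>[OF uv(2)] by simp
  qed
  then show ?thesis by blast
qed

text \<open>Converse of \<open>parallel_imp_constant_components\<close>: the derivative of such a
  field is a combination of \<open>X\<close> and \<open>t\<close>, so its normal part
  vanishes.\<close>

lemma constant_components_normal_field:
  assumes \<nu>: "\<And>p. \<nu> p = \<alpha> *\<^sub>R n (snd p) + \<beta> *\<^sub>R N p"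
  shows "\<nu> differentiable_on S"
    and "p \<in> S \<Longrightarrow> \<nu> p \<in> Defs.normal_space S z p"
    and "p \<in> S \<Longrightarrow> normal_connection S z \<nu> p \<xi> = 0"
proof -
  define \<nu>' where "\<nu>' p \<xi> = \<alpha> *\<^sub>R ((- snd \<xi> * \<kappa> (snd p)) *\<^sub>R t (snd p)) +
      \<beta> *\<^sub>R ((- fst \<xi> * \<kappa>\<^sub>m (fst p)) *\<^sub>R X p - (snd \<xi> * g1 (fst p)) *\<^sub>R t (snd p))" for p \<xi>
  have deriv: "(\<nu> has_derivative \<nu>' p) (at p within S)" if "p \<in> S" for p
    unfolding \<nu>[abs_def] \<nu>'_def
    by (intro derivative_intros n_has_derivative[OF that] N_has_derivative[OF that])
  then show "\<nu> differentiable_on S"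
    by (auto simp: differentiable_on_def differentiable_def)
  assume p: "p \<in> S"
  note inn = frame[OF p] frame_l_n[of "snd p"]
  show "\<nu> p \<in> Defs.normal_space S z p"
    using p inn by (auto simp: normal_space_z_iff[OF p] \<nu> inner_add_left inner_add_right inner_commute)
  show "normal_connection S z \<nu> p \<xi> = 0"
    using p inn
    by (auto simp: normal_connection_def differential_eq[OF p deriv[OF p]] normal_part_eq_zero_iff[OF p]
        \<nu>'_def inner_add_left inner_add_right inner_diff_left inner_diff_right inner_commute)
qed

text \<open>Under this hypothesis the mean curvature vector is a multiple of
  \<open>n + \<mu> N\<close>, a fixed direction in the parallel frame. Normalizing it and rotating
  by a right angle gives the geometric frame.\<close>

lemma proportional_imp_parallel:
  assumes \<mu>: "\<And>u v. u \<in> I \<Longrightarrow> v \<in> J \<Longrightarrow> W u = \<mu> * \<kappa> v" and \<kappa>: "\<And>v. v \<in> J \<Longrightarrow> \<kappa> v \<noteq> 0"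
  shows "parallel_normal_bundle S z"
proof -
  define r where "r = 1 / sqrt (1 + \<mu>\<^sup>2)"
  have r: "r \<noteq> 0" "r * r * (1 + \<mu> * \<mu>) = 1"
    by (auto simp: r_def power2_eq_square add_nonneg_eq_0_iff)
  define \<b> where "\<b> p = r *\<^sub>R n (snd p) + (r * \<mu>) *\<^sub>R N p" for p
  define \<l> where "\<l> p = (- r * \<mu>) *\<^sub>R n (snd p) + r *\<^sub>R N p" for p
  note \<b> = constant_components_normal_field[of \<b>, OF \<b>_def]
  note \<l> = constant_components_normal_field[of \<l>, OF \<l>_def]
  have "geometric_normal_frame S z \<b> \<l>"
    unfolding geometric_normal_frame_def
  proof (intro conjI ballI \<b> \<l>)
    fix p assume p: "p \<in> S"
    then have uv: "fst p \<in> I" "snd p \<in> J" by auto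
    note inn = frame[OF p] frame_l_n[OF uv(2)]
    \<comment> \<open>The factor relating \<open>(\<kappa> / (2 f)) (n + \<mu> N)\<close> to
      \<open>\<b> = r (n + \<mu> N)\<close>.\<close>
    define s where "s = \<kappa> (snd p) / (2 * f (fst p) * r)"
    have s: "s \<noteq> 0" using \<kappa>[OF uv(2)] meridian_simps(2)[OF uv(1)] r by (simp add: s_def)
    have H: "mean_curvature_vector S z p = s *\<^sub>R \<b> p"
      using r unfolding mean_curvature_vector_z[OF p] \<mu>[OF uv] \<b>_def s_def
      by (simp add: algebra_simps)
    show norm: "norm (\<b> p) = 1" "norm (\<l> p) = 1"
      using inn r(2) by (auto simp: norm_eq_1 \<b>_def \<l>_def algebra_simps inner_commute)
    show "\<b> p \<bullet> \<l> p = 0"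
      using inn by (simp add: \<b>_def \<l>_def algebra_simps inner_commute)
    show "mean_curvature_vector S z p \<noteq> 0"
      using H s norm(1) by auto
    have "\<b> p = (1 / s) *\<^sub>R mean_curvature_vector S z p" using H s by simp
    then show "collinear {0, mean_curvature_vector S z p, \<b> p}"
      unfolding collinear_lemma by blast
  qed
  then show ?thesis
    unfolding parallel_normal_bundle_def using \<b>(3) \<l>(3) by blast
qed

text \<open>Separation of variables: \<open>W\<close> depends on \<open>u\<close> and
  \<open>\<kappa>\<close> on \<open>v\<close> only, so \<open>W = \<mu> \<kappa>\<close> with
  \<open>\<mu> \<noteq> 0\<close> forces both to be constant, while \<open>\<mu> = 0\<close> means
  \<open>W = 0\<close>.\<close>

lemma parallel_normal_bundle_iff:
  assumes \<kappa>: "\<And>v. v \<in> J \<Longrightarrow> \<kappa> v \<noteq> 0"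
  shows "parallel_normal_bundle S z \<longleftrightarrow>
    (\<forall>u\<in>I. W u = 0) \<or> (\<exists>a b. a \<noteq> 0 \<and> (\<forall>u\<in>I. W u = a) \<and> (\<forall>v\<in>J. \<kappa> v = b))"
proof
  obtain u0 v0 where u0: "u0 \<in> I" and v0: "v0 \<in> J"
    using nondegenerate_I nondegenerate_J interior_subset by (fastforce simp: nondegenerate_interval_def)
  assume "parallel_normal_bundle S z"
  then obtain \<mu> where \<mu>: "\<And>u v. u \<in> I \<Longrightarrow> v \<in> J \<Longrightarrow> W u = \<mu> * \<kappa> v"
    using parallel_imp_proportional \<kappa> by blast
  show "(\<forall>u\<in>I. W u = 0) \<or> (\<exists>a b. a \<noteq> 0 \<and> (\<forall>u\<in>I. W u = a) \<and> (\<forall>v\<in>J. \<kappa> v = b))"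
  proof (cases "\<mu> = 0")
    case True
    then show ?thesis using \<mu> v0 by auto
  next
    case False
    have "\<mu> * \<kappa> v0 \<noteq> 0" using False \<kappa>[OF v0] by simp
    moreover have "W u = \<mu> * \<kappa> v0" if "u \<in> I" for u using \<mu>[OF that v0] .
    moreover have "\<kappa> v = \<kappa> v0" if "v \<in> J" for v
      using \<mu>[OF u0 that] \<mu>[OF u0 v0] False by simp
    ultimately show ?thesis by blast
  qed
next
  assume "(\<forall>u\<in>I. W u = 0) \<or> (\<exists>a b. a \<noteq> 0 \<and> (\<forall>u\<in>I. W u = a) \<and> (\<forall>v\<in>J. \<kappa> v = b))"
  then show "parallel_normal_bundle S z"
  proof (elim disjE exE conjE)
    assume "\<forall>u\<in>I. W u = 0"
    then show ?thesis by (intro proportional_imp_parallel[of 0] \<kappa>) auto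
  next
    fix a b assume "\<forall>u\<in>I. W u = a" "\<forall>v\<in>J. \<kappa> v = b"
    then show ?thesis
      using \<kappa> by (intro proportional_imp_parallel[of "a / b"] \<kappa>) auto
  qed
qed

end

section \<open>Translation of the two alternatives for \<open>W\<close> into the cases (i) and
  (ii)\<close>

theorem theorem5p1:
  fixes I J :: "real set" and f g :: "real \<Rightarrow> real" and l n :: "real \<Rightarrow> real^4"
  assumes meridian: "meridian_curve I f g"
    and spherical: "spherical_curve_with_normal J l n"
    and general: "general_class I J f g l n"
    and orientation: "(\<forall>v\<in>J. spherical_curvature J l n v \<noteq> 0) \<longrightarrow>
                      (\<forall>v\<in>J. spherical_curvature J l n v > 0)"
  shows "parallel_normal_bundle (I \<times> J) (meridian_surface f g l) \<longleftrightarrow>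
    (\<exists>a c d s\<^sub>1 s\<^sub>2 :: real. d > c\<^sup>2 \<and> s\<^sub>1 \<in> {1, -1} \<and> s\<^sub>2 \<in> {1, -1} \<and>
       (\<forall>u\<in>I. u\<^sup>2 + 2 * c * u + d \<ge> 0 \<and>
          f u = s\<^sub>1 * sqrt (u\<^sup>2 + 2 * c * u + d) \<and>
          g u = s\<^sub>2 * sqrt (d - c\<^sup>2) * ln \<bar>u + c + sqrt (u\<^sup>2 + 2 * c * u + d)\<bar> + a))
    \<or>
    (\<exists>a b c :: real. b > 0 \<and> a \<noteq> 0 \<and>
       (\<exists>C. circle_on_sphere2 C \<and> l ` J \<subseteq> C) \<and>
       (\<forall>v\<in>J. spherical_curvature J l n v = b) \<and>
       satisfies_slope_equation I f a c \<and>
       (\<forall>u\<in>I. deriv_within I g u = sqrt (1 - (deriv_within I f u)\<^sup>2)))"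
    (is "_ \<longleftrightarrow> ?i \<or> ?ii")
proof -
  interpret meridian_surface_in_R4 I J f g l n
    by unfold_locales (fact meridian, fact spherical)
  have \<kappa>\<^sub>m: "\<kappa>\<^sub>m u \<noteq> 0" if "u \<in> I" for u
    using general that by (simp add: general_class_def)
  \<comment> \<open>The choice of orientation upgrades nonvanishing curvature to positive curvature,
    which later gives \<open>b > 0\<close>.\<close>
  have \<kappa>: "\<kappa> v > 0" if "v \<in> J" for v
    using general orientation that by (simp add: general_class_def)
  obtain v0 where v0: "v0 \<in> J"
    using nondegenerate_J interior_subset by (fastforce simp: nondegenerate_interval_def)
  have iff: "parallel_normal_bundle S z \<longleftrightarrow>
      ?i \<or> (\<exists>a b. a \<noteq> 0 \<and> (\<forall>u\<in>I. W u = a) \<and> (\<forall>v\<in>J. \<kappa> v = b))"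
    unfolding W_zero_iff_explicit[symmetric]
    using \<kappa> by (intro parallel_normal_bundle_iff) force
  show ?thesis
  proof
    assume "parallel_normal_bundle S z"
    then show "?i \<or> ?ii"
      unfolding iff
    proof (rule disj_forward)
      assume "\<exists>a b. a \<noteq> 0 \<and> (\<forall>u\<in>I. W u = a) \<and> (\<forall>v\<in>J. \<kappa> v = b)"
      then obtain a b where a: "a \<noteq> 0" "\<And>u. u \<in> I \<Longrightarrow> W u = a" and b: "\<And>v. v \<in> J \<Longrightarrow> \<kappa> v = b"
        by blast
      obtain c where "satisfies_slope_equation I f a c"
        using W_constant_imp_slope_equation[OF a(2)] by blast
      moreover have "b > 0" using \<kappa>[OF v0] b[OF v0] by simp
      moreover have "g1 u = sqrt (1 - (f1 u)\<^sup>2)" if "u \<in> I" for u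
      proof -
        have "1 - (f1 u)\<^sup>2 = (g1 u)\<^sup>2"
          using meridian_simps(1)[OF that] by (simp add: power2_eq_square)
        then show ?thesis using meridian_simps(3)[OF that] by simp
      qed
      ultimately show ?ii
        using a(1) b constant_curvature_imp_circle[OF b] by blast
    qed
  next
    assume "?i \<or> ?ii"
    then show "parallel_normal_bundle S z"
    proof
      assume ?i
      then show ?thesis unfolding iff ..
    next
      assume ?ii
      then obtain a b c where b: "\<forall>v\<in>J. \<kappa> v = b" and slope: "satisfies_slope_equation I f a c"
        by (elim exE conjE)
      obtain w where w: "\<And>u. u \<in> I \<Longrightarrow> W u = w"
        using slope_equation_imp_W_constant[OF slope \<kappa>\<^sub>m] by blast
      have \<kappa>0: "\<And>v. v \<in> J \<Longrightarrow> \<kappa> v \<noteq> 0" using \<kappa> by force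
      \<comment> \<open>Only some constant value \<open>w\<close> of \<open>W\<close> is known here:
        \<open>w = 0\<close> falls under the first alternative of
        \<open>parallel_normal_bundle_iff\<close>, any other value under the second.\<close>
      show ?thesis
        using b w by (cases "w = 0") (auto simp: parallel_normal_bundle_iff[OF \<kappa>0])
    qed
  qed
qed

end
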